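(* For any positive real number $n$, the following hold: (i) $A'_{4,n}=A_{4,n}+\sqrt 2$; (ii) $A'_{2,n}=\sqrt{A_{2,n}^2+\sqrt 2}$; (iii) $A'_{1,n}=\sqrt[4]{A_{1,n}^4+1}$; (iv) $4(A'_{1/2,n})^4-(A'_{1/2,n})^{-4}=4A_{1/2,n}^4$.
   Context: For $|q|<1$, let $\varphi(q)=\sum_{m=-\infty}^{\infty}q^{m^2}$ and $\psi(q)=\sum_{m=0}^{\infty}q^{m(m+1)/2}$. For positive real $k,n$ define, with $q=e^{-\pi\sqrt{n/k}}$, $$A_{k,n}=\frac{\varphi(-q)}{2k^{1/4}q^{k/4}\psi(q^{2k})},\qquad A'_{k,n}=\frac{\varphi(q)}{2k^{1/4}q^{k/4}\psi(q^{2k})}.$$ *)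

theory Defs
  imports "HOL-Analysis.Analysis"
begin

text \<open>
  Both theta functions are meaningful for \<open>norm q < 1\<close>, where the defining series
  converge absolutely; outside that disc their values carry no meaning.
\<close>

definition ramanujan_phi :: "'a::{real_normed_field, banach} \<Rightarrow> 'a" where
  "ramanujan_phi q = (\<Sum>\<^sub>\<infinity>m\<in>(UNIV :: int set). q powi (m\<^sup>2))"

definition ramanujan_psi :: "'a::{real_normed_field, banach} \<Rightarrow> 'a" where
  "ramanujan_psi q = (\<Sum>m::nat. q ^ (m * (m + 1) div 2))"

definition nome :: "real \<Rightarrow> real \<Rightarrow> real" where
  "nome k n = exp (- pi * sqrt (n / k))"

text \<open>
  The parameters are intended to be positive; then \<open>0 < nome k n < 1\<close>, so the real
  powers below are taken of positive numbers.
\<close>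

definition A_param :: "real \<Rightarrow> real \<Rightarrow> real" where
  "A_param k n = (let q = nome k n in
     ramanujan_phi (- q) / (2 * k powr (1/4) * q powr (k/4) * ramanujan_psi (q powr (2 * k))))"

definition A'_param :: "real \<Rightarrow> real \<Rightarrow> real" where
  "A'_param k n = (let q = nome k n in
     ramanujan_phi q / (2 * k powr (1/4) * q powr (k/4) * ramanujan_psi (q powr (2 * k))))"

end

theory Submission
  imports Defs
begin

text \<open>
  Clearing denominators, the four claims amount to
  \<open>\<phi>(q) - \<phi>(-q) = 4 q \<psi>(q^8)\<close>, \<open>\<phi>(q)^2 - \<phi>(-q)^2 = 8 q \<psi>(q^4)^2\<close>, Jacobi's quartic identity
  \<open>\<phi>(q)^4 - \<phi>(-q)^4 = 16 q \<psi>(q^2)^4\<close>, and the latter combined with \<open>\<psi>(q)^2 = \<phi>(q) \<psi>(q^2)\<close>.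
  Splitting \<open>\<phi>\<close> into even and odd exponents gives the first identity and
  \<open>\<phi>(q) + \<phi>(-q) = 2 \<phi>(q^4)\<close>. Substituting \<open>(a, b) = (u + v, u - v)\<close> in double series over pairs
  with \<open>a + b\<close> even gives the product formula for \<open>\<psi>(q)^2\<close> and
  \<open>\<phi>(q)^2 + \<phi>(-q)^2 = 2 \<phi>(q^2)^2\<close>. The quadratic and quartic identities follow by factoring
  differences of squares.
\<close>

section \<open>Integer powers and absolutely summable bilateral series\<close>

lemma powi_add_nonneg:
  fixes q :: "'a::field"
  assumes "m \<ge> 0" "n \<ge> 0"
  shows "q powi (m + n) = q powi m * q powi n"
  \<comment> \<open>At base 0 the exponent law of \<open>powi\<close> fails for exponents of mixed
    sign, so both powers are read as natural powers.\<close>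
  using assms by (simp add: power_int_def nat_add_distrib power_add)

lemma norm_powi_nonneg_le:
  fixes q :: "'a::real_normed_field"
  assumes "norm q \<le> 1" "0 \<le> m" "m \<le> n"
  shows "norm (q powi n) \<le> norm q powi m"
  using assms by (simp add: power_int_def norm_power power_decreasing nat_mono)

lemma UNIV_int_halves: "(UNIV :: int set) = range int \<union> range (\<lambda>n. - 1 - int n)"
proof -
  have "m \<in> range int \<union> range (\<lambda>n. - 1 - int n)" for m :: int
    by (cases "m \<ge> 0") (auto simp: image_iff intro: exI[of _ "nat m"] exI[of _ "nat (- 1 - m)"])
  thus ?thesis by blast
qed

text \<open>Cutting between -1 and 0 makes the two halves mirror images under m -> -1 - m, the
  reflection that fixes triangular exponents.\<close>

lemma has_sum_int_halves:
  fixes f :: "int \<Rightarrow> 'a::topological_comm_monoid_add"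
  assumes "((\<lambda>n::nat. f (int n)) has_sum a) UNIV"
    and "((\<lambda>n::nat. f (- 1 - int n)) has_sum b) UNIV"
  shows "(f has_sum (a + b)) UNIV"
  unfolding UNIV_int_halves
proof (rule has_sum_Un_disjoint)
  show "(f has_sum a) (range int)"
    using assms(1) by (subst has_sum_reindex) (auto simp: o_def)
  show "(f has_sum b) (range (\<lambda>n. - 1 - int n))"
    using assms(2) by (subst has_sum_reindex) (auto simp: o_def inj_on_def)
  show "range int \<inter> range (\<lambda>n. - 1 - int n) = {}"
    by auto
qed

text \<open>On each half the exponent is at least the index, so the geometric series in
  \<open>norm q\<close> dominates.\<close>

lemma abs_summable_on_powi:
  fixes q :: "'a::{real_normed_field, banach}" and e :: "int \<Rightarrow> int"
  assumes q: "norm q < 1"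
    and pos: "\<And>n::nat. int n \<le> e (int n)" and neg: "\<And>n::nat. int n \<le> e (- 1 - int n)"
  shows "(\<lambda>m. norm (q powi e m)) summable_on UNIV"
proof -
  have "(\<lambda>n. norm q ^ n) summable_on (UNIV :: nat set)"
    using q by (intro norm_summable_imp_summable_on) (simp add: norm_power summable_geometric)
  hence *: "(\<lambda>n. norm (q powi g n)) summable_on UNIV" if "\<And>n. int n \<le> g n" for g :: "nat \<Rightarrow> int"
  proof (rule Infinite_Sum.abs_summable_on_comparison_test')
    fix n :: nat
    show "norm (q powi g n) \<le> norm q ^ n"
      using norm_powi_nonneg_le[of q "int n" "g n"] q that[of n] by simp
  qed
  show ?thesis
    using has_sum_int_halves[OF has_sum_infsum[OF *[OF pos]] has_sum_infsum[OF *[OF neg]]]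
    by (auto simp: summable_on_def)
qed

lemma int_le_triangle: "int n \<le> int n * (int n + 1) div 2"
proof -
  have "n \<le> n * (n + 1) div 2"
    by (cases n) (auto simp: less_eq_div_iff_mult_less_eq)
  hence "int n \<le> int (n * (n + 1) div 2)" by linarith
  thus ?thesis by (simp add: zdiv_int algebra_simps)
qed

lemma abs_summable_on_powi_square:
  fixes q :: "'a::{real_normed_field, banach}"
  assumes "norm q < 1"
  shows "(\<lambda>m::int. norm (q powi m\<^sup>2)) summable_on UNIV"
proof (rule abs_summable_on_powi[OF assms])
  fix n :: nat
  show "int n \<le> (int n)\<^sup>2"
    by (metis of_nat_le_iff of_nat_power power2_nat_le_imp_le order_refl le_square power2_eq_square)
  thus "int n \<le> (- 1 - int n)\<^sup>2" by (simp add: power2_eq_square algebra_simps)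
qed

lemma abs_summable_on_powi_triangle:
  fixes q :: "'a::{real_normed_field, banach}"
  assumes "norm q < 1"
  shows "(\<lambda>m::int. norm (q powi (m * (m + 1) div 2))) summable_on UNIV"
proof (rule abs_summable_on_powi[OF assms])
  fix n :: nat
  show "int n \<le> int n * (int n + 1) div 2" by (rule int_le_triangle)
  thus "int n \<le> (- 1 - int n) * (- 1 - int n + 1) div 2"
    by (simp add: algebra_simps)
qed

lemma has_sum_phi:
  fixes q :: "'a::{real_normed_field, banach}"
  assumes "norm q < 1"
  shows "((\<lambda>m. q powi m\<^sup>2) has_sum ramanujan_phi q) UNIV"
  unfolding ramanujan_phi_def
  by (rule has_sum_infsum[OF abs_summable_summable[OF abs_summable_on_powi_square[OF assms]]])

text \<open>The symmetry \<open>m \<mapsto> - 1 - m\<close> of the triangular numbers makes the bilateral series twice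
  the unilateral one.\<close>

lemma has_sum_psi:
  fixes q :: "'a::{real_normed_field, banach}"
  assumes "norm q < 1"
  shows "((\<lambda>m. q powi (m * (m + 1) div 2)) has_sum (2 * ramanujan_psi q)) UNIV"
proof -
  let ?f = "\<lambda>m::int. q powi (m * (m + 1) div 2)"
  have eq: "?f (int n) = q ^ (n * (n + 1) div 2)" for n
  proof -
    have "int n * (int n + 1) div 2 = int (n * (n + 1) div 2)"
      by (simp add: zdiv_int algebra_simps)
    thus ?thesis by (simp only: power_int_of_nat)
  qed
  have eq': "?f (- 1 - int n) = ?f (int n)" for n
    by (simp add: algebra_simps)
  have "?f summable_on range int"
    by (rule summable_on_subset_banach[OF abs_summable_summable[OF abs_summable_on_powi_triangle[OF assms]]]) simp
  hence "(\<lambda>n. ?f (int n)) summable_on UNIV"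
    by (subst (asm) summable_on_reindex) (auto simp: o_def)
  then obtain s where s: "((\<lambda>n. ?f (int n)) has_sum s) UNIV"
    by (auto simp: summable_on_def)
  hence "s = ramanujan_psi q"
    unfolding eq ramanujan_psi_def by (intro sums_unique has_sum_imp_sums)
  with has_sum_int_halves[of ?f s s] s show ?thesis
    unfolding eq' by simp
qed

section \<open>Parity splitting and products of series\<close>

lemma has_sum_int_even:
  fixes f :: "int \<Rightarrow> 'a::topological_comm_monoid_add"
  assumes "(f has_sum s) UNIV" "\<And>m. odd m \<Longrightarrow> f m = 0"
  shows "((\<lambda>j. f (2 * j)) has_sum s) UNIV"
proof -
  have "(f has_sum s) {m. even m}"
    using assms by (subst has_sum_cong_neutral[where T = UNIV and g = f]) auto
  thus ?thesis
    by (subst has_sum_reindex_bij_witness[where i = "\<lambda>m. m div 2" and j = "\<lambda>j. 2 * j"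
          and T = "{m. even m}" and h = f]) auto
qed

lemma has_sum_int_odd:
  fixes f :: "int \<Rightarrow> 'a::topological_comm_monoid_add"
  assumes "(f has_sum s) UNIV" "\<And>m. even m \<Longrightarrow> f m = 0"
  shows "((\<lambda>j. f (2 * j + 1)) has_sum s) UNIV"
proof -
  have "(f has_sum s) {m. odd m}"
    using assms by (subst has_sum_cong_neutral[where T = UNIV and g = f]) auto
  thus ?thesis
    by (subst has_sum_reindex_bij_witness[where i = "\<lambda>m. m div 2" and j = "\<lambda>j. 2 * j + 1"
          and T = "{m. odd m}" and h = f]) auto
qed

text \<open>Halving sum and difference is exact on pairs of even sum and inverts (u, v) -> (u + v, u
  - v). This change of variables diagonalizes the exponents of the double series.\<close>

lemma has_sum_even_pairs:
  fixes f :: "int \<times> int \<Rightarrow> 'a::topological_comm_monoid_add"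
  shows "(f has_sum s) {(a, b). even (a + b)} \<longleftrightarrow> ((\<lambda>(u, v). f (u + v, u - v)) has_sum s) UNIV"
proof (rule has_sum_reindex_bij_witness[where i = "\<lambda>(u, v). (u + v, u - v)"
      and j = "\<lambda>(a, b). ((a + b) div 2, (a - b) div 2)"])
  have sum: "(a + b) div 2 + (a - b) div 2 = a" and diff: "(a + b) div 2 - (a - b) div 2 = b"
    if "even (a + b)" for a b :: int
    using that by presburger+
  fix x :: "int \<times> int" assume x: "x \<in> {(a, b). even (a + b)}"
  thus "(case case x of (a, b) \<Rightarrow> ((a + b) div 2, (a - b) div 2) of (u, v) \<Rightarrow> (u + v, u - v)) = x"
    using sum diff by auto
  show "(case case x of (a, b) \<Rightarrow> ((a + b) div 2, (a - b) div 2) of (u, v) \<Rightarrow> f (u + v, u - v)) = f x"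
    using x sum diff by auto
qed auto

text \<open>Absolute summability of the factors makes the product family summable, and Fubini then
  evaluates it as an iterated sum.\<close>

lemma has_sum_mult_Times:
  fixes f :: "'b \<Rightarrow> 'a::{real_normed_field, banach}" and g :: "'c \<Rightarrow> 'a"
  assumes f: "(\<lambda>x. norm (f x)) summable_on A" "(f has_sum a) A" and g: "(\<lambda>y. norm (g y)) summable_on B" "(g has_sum b) B"
  shows "((\<lambda>(x, y). f x * g y) has_sum (a * b)) (A \<times> B)"
proof -
  have inner: "(\<lambda>y. norm (f x * g y)) summable_on B" for x
    using summable_on_cmult_right[OF g(1), of "norm (f x)"] by (simp add: norm_mult)
  have "(\<Sum>\<^sub>\<infinity>y\<in>B. norm (f x * g y)) = norm (f x) * (\<Sum>\<^sub>\<infinity>y\<in>B. norm (g y))" for x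
    by (simp add: norm_mult infsum_cmult_right')
  moreover have "(\<lambda>x. norm (norm (f x) * (\<Sum>\<^sub>\<infinity>y\<in>B. norm (g y)))) summable_on A"
    using summable_on_cmult_left[OF f(1), of "\<Sum>\<^sub>\<infinity>y\<in>B. norm (g y)"]
    by (simp add: abs_mult infsum_nonneg)
  ultimately have "(\<lambda>z. norm (case z of (x, y) \<Rightarrow> f x * g y)) summable_on A \<times> B"
    unfolding Infinite_Sum.abs_summable_on_Sigma_iff using inner by simp
  hence summ: "(\<lambda>(x, y). f x * g y) summable_on A \<times> B"
    by (rule abs_summable_summable)
  have "infsum (\<lambda>(x, y). f x * g y) (A \<times> B) = infsum (\<lambda>x. infsum (\<lambda>y. f x * g y) B) A"
    using infsum_Sigma_banach[OF summ] by simp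
  also have "\<dots> = a * b"
    using f(2) g(2) by (simp add: infsum_cmult_right' infsum_cmult_left' infsumI)
  finally show ?thesis using has_sum_infsum[OF summ] by simp
qed

section \<open>Theta function identities\<close>

lemma powi_triangle_8: "(q ^ 8) powi (j * (j + 1) div 2) * q = (q::'a::field) powi ((2 * j + 1)\<^sup>2)"
proof -
  define t where "t = j * (j + 1) div 2"
  have "2 * t = j * (j + 1)" unfolding t_def by simp
  \<comment> \<open>An odd square is one more than eight times a triangular number; this is how
    psi(q^8) arises from the odd part of phi(q).\<close>
  hence eq: "(2 * j + 1)\<^sup>2 = 8 * t + 1"
    by (simp add: power2_eq_square algebra_simps)
  have nn: "0 \<le> t" unfolding t_def by (cases "j \<ge> 0") (auto simp: zero_le_mult_iff)
  show ?thesis using nn by (simp add: eq powi_add_nonneg power_int_power flip: t_def)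
qed

text \<open>Since m^2 has the parity of m, the terms with odd m cancel; those with m = 2j double and
  have exponent 4 j^2.\<close>

lemma phi_add_phi_minus:
  fixes q :: "'a::{real_normed_field, banach}"
  assumes "norm q < 1"
  shows "ramanujan_phi q + ramanujan_phi (- q) = 2 * ramanujan_phi (q ^ 4)"
proof -
  let ?f = "\<lambda>m::int. q powi m\<^sup>2 + (- q) powi m\<^sup>2"
  have 1: "(?f has_sum (ramanujan_phi q + ramanujan_phi (- q))) UNIV"
    using assms by (intro has_sum_add has_sum_phi) auto
  have 2: "((\<lambda>j. ?f (2 * j)) has_sum (ramanujan_phi q + ramanujan_phi (- q))) UNIV"
    by (rule has_sum_int_even[OF 1]) simp
  have "norm (q ^ 4) < 1" using assms by (simp add: norm_power power_less_one_iff)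
  from has_sum_cmult_right[OF has_sum_phi[OF this], of 2]
  have "((\<lambda>j. ?f (2 * j)) has_sum (2 * ramanujan_phi (q ^ 4))) UNIV"
    by (simp add: power_mult_distrib power_int_power)
  with 2 show ?thesis by (rule has_sum_unique)
qed

lemma phi_diff_phi_minus:
  fixes q :: "'a::{real_normed_field, banach}"
  assumes "norm q < 1"
  shows "ramanujan_phi q - ramanujan_phi (- q) = 4 * q * ramanujan_psi (q ^ 8)"
proof -
  let ?f = "\<lambda>m::int. q powi m\<^sup>2 - (- q) powi m\<^sup>2"
  have 1: "(?f has_sum (ramanujan_phi q - ramanujan_phi (- q))) UNIV"
    using has_sum_add[OF has_sum_phi[OF assms] has_sum_uminusI[OF has_sum_phi[of "- q"]]] assms by simp
  have 2: "((\<lambda>j. ?f (2 * j + 1)) has_sum (ramanujan_phi q - ramanujan_phi (- q))) UNIV"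
    by (rule has_sum_int_odd[OF 1]) simp
  have 3: "?f (2 * j + 1) = 2 * q * ((q ^ 8) powi (j * (j + 1) div 2))" for j
    using powi_triangle_8[of q j] by (simp add: power_int_minus_left algebra_simps)
  have "norm (q ^ 8) < 1" using assms by (simp add: norm_power power_less_one_iff)
  \<comment> \<open>The bilateral series counts psi twice, which together with the doubled odd terms
    gives the coefficient 4.\<close>
  from has_sum_cmult_right[OF has_sum_psi[OF this], of "2 * q"]
  have "((\<lambda>j. ?f (2 * j + 1)) has_sum (4 * q * ramanujan_psi (q ^ 8))) UNIV"
    unfolding 3 by (simp add: algebra_simps)
  with 2 show ?thesis by (rule has_sum_unique)
qed

lemma has_sum_phi_phi:
  fixes q :: "'a::{real_normed_field, banach}"
  assumes "norm q < 1"
  shows "((\<lambda>(a, b). q powi a\<^sup>2 * q powi b\<^sup>2) has_sum (ramanujan_phi q)\<^sup>2) UNIV"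
  using has_sum_mult_Times[OF abs_summable_on_powi_square[OF assms] has_sum_phi[OF assms]
      abs_summable_on_powi_square[OF assms] has_sum_phi[OF assms]]
  by (simp add: power2_eq_square)

lemma phi_sq_add_phi_minus_sq:
  fixes q :: "'a::{real_normed_field, banach}"
  assumes "norm q < 1"
  shows "(ramanujan_phi q)\<^sup>2 + (ramanujan_phi (- q))\<^sup>2 = 2 * (ramanujan_phi (q\<^sup>2))\<^sup>2"
proof -
  let ?E = "{(a::int, b::int). even (a + b)}"
  let ?g = "\<lambda>(a, b). 2 * (q powi a\<^sup>2 * q powi b\<^sup>2)"
  define s where "s = (ramanujan_phi q)\<^sup>2 + (ramanujan_phi (- q))\<^sup>2"
  have "((\<lambda>x. (case x of (a, b) \<Rightarrow> q powi a\<^sup>2 * q powi b\<^sup>2) +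
          (case x of (a, b) \<Rightarrow> (- q) powi a\<^sup>2 * (- q) powi b\<^sup>2)) has_sum s) UNIV"
    unfolding s_def using assms by (intro has_sum_add has_sum_phi_phi) auto
  \<comment> \<open>The sign of the second summand is (-1)^(a + b): pairs of odd sum cancel, the
    others double.\<close>
  hence "(?g has_sum s) ?E"
    by (subst has_sum_cong_neutral[where T = UNIV]) (auto simp: power_int_minus_left split: if_splits)
  hence 1: "((\<lambda>(u, v). ?g (u + v, u - v)) has_sum s) UNIV"
    unfolding has_sum_even_pairs .
  have eq: "?g (u + v, u - v) = 2 * ((q\<^sup>2) powi u\<^sup>2 * (q\<^sup>2) powi v\<^sup>2)" for u v
  proof -
    have "(u + v)\<^sup>2 + (u - v)\<^sup>2 = 2 * u\<^sup>2 + 2 * v\<^sup>2" by (simp add: power2_eq_square algebra_simps)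
    hence "q powi (u + v)\<^sup>2 * q powi (u - v)\<^sup>2 = q powi (2 * u\<^sup>2) * q powi (2 * v\<^sup>2)"
      using powi_add_nonneg[of "(u + v)\<^sup>2" "(u - v)\<^sup>2" q] powi_add_nonneg[of "2 * u\<^sup>2" "2 * v\<^sup>2" q]
      by simp
    thus ?thesis by (simp add: power_int_power)
  qed
  have "norm (q\<^sup>2) < 1" using assms by (simp add: norm_power power_less_one_iff)
  from has_sum_cmult_right[OF has_sum_phi_phi[OF this], of 2]
  have "((\<lambda>(u, v). ?g (u + v, u - v)) has_sum (2 * (ramanujan_phi (q\<^sup>2))\<^sup>2)) UNIV"
    unfolding eq by (simp add: case_prod_unfold)
  with 1 have "s = 2 * (ramanujan_phi (q\<^sup>2))\<^sup>2" by (rule has_sum_unique)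
  thus ?thesis by (simp add: s_def)
qed

text \<open>The involution \<open>(a, b) \<mapsto> (a, - 1 - b)\<close> exchanges the pairs with even and with odd sum and
  preserves the exponent, so the even pairs carry half of the double series.\<close>

lemma psi_sq:
  fixes q :: "'a::{real_normed_field, banach}"
  assumes "norm q < 1"
  shows "(ramanujan_psi q)\<^sup>2 = ramanujan_phi q * ramanujan_psi (q\<^sup>2)"
proof -
  define t where "t m = m * (m + 1) div 2" for m :: int
  have t2: "2 * t m = m * (m + 1)" for m by (simp add: t_def)
  have t_nonneg: "t m \<ge> 0" for m
    unfolding t_def by (cases "m \<ge> 0") (auto simp: zero_le_mult_iff)
  have t_refl: "t (- 1 - m) = t m" for m by (simp add: t_def algebra_simps)
  let ?E = "{(a::int, b::int). even (a + b)}"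
  let ?g = "\<lambda>(a, b). q powi t a * q powi t b"
  note summ = abs_summable_on_powi_triangle[OF assms, folded t_def]
  note psi = has_sum_psi[OF assms, folded t_def]
  have psi2: "(?g has_sum (2 * ramanujan_psi q * (2 * ramanujan_psi q))) UNIV"
    using has_sum_mult_Times[OF summ psi summ psi] by (simp only: UNIV_Times_UNIV)
  hence "?g summable_on UNIV" by (rule has_sum_imp_summable)
  hence "?g summable_on ?E" by (rule summable_on_subset_banach) (rule subset_UNIV)
  then obtain s where s: "(?g has_sum s) ?E" by (auto simp: summable_on_def)
  hence "(?g has_sum s) (- ?E)"
    by (subst has_sum_reindex_bij_witness[where i = "\<lambda>(a, b). (a, - 1 - b)"
          and j = "\<lambda>(a, b). (a, - 1 - b)" and T = ?E and h = ?g]) (auto simp: t_refl)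
  with s have "(?g has_sum (s + s)) (?E \<union> - ?E)"
    by (rule has_sum_Un_disjoint) simp
  hence "(?g has_sum (s + s)) UNIV" by (simp only: Compl_partition)
  hence ss: "s + s = 2 * ramanujan_psi q * (2 * ramanujan_psi q)"
    using psi2 by (rule has_sum_unique)
  from s have 1: "((\<lambda>(u, v). ?g (u + v, u - v)) has_sum s) UNIV"
    unfolding has_sum_even_pairs .
  have eq: "?g (u + v, u - v) = (q\<^sup>2) powi t u * q powi v\<^sup>2" for u v
  proof -
    \<comment> \<open>Doubling removes the division in \<open>t\<close> and leaves a polynomial
      identity.\<close>
    have "2 * (t (u + v) + t (u - v)) = 2 * (2 * t u + v\<^sup>2)"
      unfolding distrib_left[of 2] t2 by (simp add: t2 power2_eq_square algebra_simps)
    hence "t (u + v) + t (u - v) = 2 * t u + v\<^sup>2" by simp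
    hence "q powi t (u + v) * q powi t (u - v) = q powi (2 * t u) * q powi v\<^sup>2"
      using powi_add_nonneg[OF t_nonneg t_nonneg, of q "u + v" "u - v"]
        powi_add_nonneg[of "2 * t u" "v\<^sup>2" q] t_nonneg[of u]
      by simp
    thus ?thesis by (simp add: power_int_power)
  qed
  have "norm (q\<^sup>2) < 1" using assms by (simp add: norm_power power_less_one_iff)
  from has_sum_mult_Times[OF abs_summable_on_powi_triangle[OF this, folded t_def]
      has_sum_psi[OF this, folded t_def]
      abs_summable_on_powi_square[OF assms] has_sum_phi[OF assms]]
  have "((\<lambda>(u, v). ?g (u + v, u - v)) has_sum (2 * ramanujan_psi (q\<^sup>2) * ramanujan_phi q)) UNIV"
    unfolding eq by simp
  with 1 have "s = 2 * ramanujan_psi (q\<^sup>2) * ramanujan_phi q" by (rule has_sum_unique)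
  \<comment> \<open>Two bilateral factors give 4 psi(q)^2 = 2 s, while \<open>s\<close> contains
    only one, namely 2 psi(q^2).\<close>
  with ss have "4 * (ramanujan_psi q)\<^sup>2 = 4 * (ramanujan_phi q * ramanujan_psi (q\<^sup>2))"
    by (simp add: power2_eq_square algebra_simps)
  thus ?thesis by simp
qed

text \<open>Sum times difference is 2 phi(q^4) times 4 q psi(q^8), and \<open>psi_sq\<close> at q^4
  merges the two theta values into a square.\<close>

lemma phi_sq_diff_phi_minus_sq:
  fixes q :: "'a::{real_normed_field, banach}"
  assumes "norm q < 1"
  shows "(ramanujan_phi q)\<^sup>2 - (ramanujan_phi (- q))\<^sup>2 = 8 * q * (ramanujan_psi (q ^ 4))\<^sup>2"
proof -
  have "norm (q ^ 4) < 1" using assms by (simp add: norm_power power_less_one_iff)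
  from psi_sq[OF this] have psi: "(ramanujan_psi (q ^ 4))\<^sup>2 = ramanujan_phi (q ^ 4) * ramanujan_psi (q ^ 8)"
    by (simp flip: power_mult)
  have "(ramanujan_phi q)\<^sup>2 - (ramanujan_phi (- q))\<^sup>2 =
      (ramanujan_phi q + ramanujan_phi (- q)) * (ramanujan_phi q - ramanujan_phi (- q))"
    by (simp add: power2_eq_square algebra_simps)
  thus ?thesis
    by (simp add: phi_add_phi_minus[OF assms] phi_diff_phi_minus[OF assms] psi)
qed

text \<open>The factors are 2 phi(q^2)^2 and 8 q psi(q^4)^2; the square of \<open>psi_sq\<close> at
  q^2 merges them into psi(q^2)^4.\<close>

lemma phi_pow4_diff_phi_minus_pow4:
  fixes q :: "'a::{real_normed_field, banach}"
  assumes "norm q < 1"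
  shows "(ramanujan_phi q) ^ 4 - (ramanujan_phi (- q)) ^ 4 = 16 * q * (ramanujan_psi (q\<^sup>2)) ^ 4"
proof -
  have "norm (q\<^sup>2) < 1" using assms by (simp add: norm_power power_less_one_iff)
  from psi_sq[OF this] have psi: "(ramanujan_psi (q\<^sup>2))\<^sup>2 = ramanujan_phi (q\<^sup>2) * ramanujan_psi (q ^ 4)"
    by (simp flip: power_mult)
  have "(ramanujan_psi (q\<^sup>2)) ^ 4 = ((ramanujan_psi (q\<^sup>2))\<^sup>2)\<^sup>2"
    by (simp flip: power_mult)
  hence psi4: "(ramanujan_psi (q\<^sup>2)) ^ 4 = (ramanujan_phi (q\<^sup>2))\<^sup>2 * (ramanujan_psi (q ^ 4))\<^sup>2"
    by (simp add: psi power_mult_distrib)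
  have "(ramanujan_phi q) ^ 4 - (ramanujan_phi (- q)) ^ 4 =
      ((ramanujan_phi q)\<^sup>2 + (ramanujan_phi (- q))\<^sup>2) * ((ramanujan_phi q)\<^sup>2 - (ramanujan_phi (- q))\<^sup>2)"
    by (simp add: power4_eq_xxxx power2_eq_square algebra_simps)
  thus ?thesis
    by (simp add: phi_sq_add_phi_minus_sq[OF assms] phi_sq_diff_phi_minus_sq[OF assms] psi4)
qed

section \<open>Positivity and the common denominator\<close>

lemma phi_pos:
  fixes q :: real
  assumes "0 < q" "q < 1"
  shows "ramanujan_phi q > 0"
proof -
  \<comment> \<open>The term at 0 is 1 and all others are nonnegative.\<close>
  have "sum (\<lambda>m. q powi m\<^sup>2) {0} \<le> ramanujan_phi q"
    using assms by (intro finite_sum_le_has_sum[OF has_sum_phi]) auto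
  thus ?thesis by simp
qed

lemma psi_pos:
  fixes q :: real
  assumes "0 < q" "q < 1"
  shows "ramanujan_psi q > 0"
proof -
  have "sum (\<lambda>m. q powi (m * (m + 1) div 2)) {0} \<le> 2 * ramanujan_psi q"
    using assms by (intro finite_sum_le_has_sum[OF has_sum_psi]) auto
  thus ?thesis by simp
qed

lemma nome_bounds:
  assumes "k > 0" "n > 0"
  shows "0 < nome k n" "nome k n < 1"
  using assms by (auto simp: nome_def)

lemma powr_quarter_pow4:
  fixes x :: real
  assumes "x > 0"
  shows "(x powr (y / 4)) ^ 4 = x powr y"
  using assms by (simp add: powr_power)

lemma powr_quarter_sq:
  fixes x :: real
  assumes "x > 0"
  shows "(x powr (y / 4))\<^sup>2 = x powr (y / 2)"
  using assms by (simp add: powr_power)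

text \<open>Isolating the denominator shared by both parameters reduces each claim to comparing a
  power of it with a theta identity.\<close>

definition A_denom :: "real \<Rightarrow> real \<Rightarrow> real" where
  "A_denom k q = 2 * k powr (1/4) * q powr (k/4) * ramanujan_psi (q powr (2 * k))"

lemma A_denom_pos:
  assumes "k > 0" "0 < q" "q < 1"
  shows "A_denom k q > 0"
proof -
  have "q powr (2 * k) < 1"
    using assms powr_less_mono2[of "2 * k" q 1] by simp
  thus ?thesis
    unfolding A_denom_def using assms by (intro mult_pos_pos psi_pos) auto
qed

lemma A_param_eq: "A_param k n = ramanujan_phi (- nome k n) / A_denom k (nome k n)"
  and A'_param_eq: "A'_param k n = ramanujan_phi (nome k n) / A_denom k (nome k n)"
  by (simp_all add: A_param_def A'_param_def A_denom_def Let_def)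

lemma A'_param_pos:
  assumes "k > 0" "n > 0"
  shows "A'_param k n > 0"
  using nome_bounds[OF assms] assms by (simp add: A'_param_eq phi_pos A_denom_pos)

section \<open>The four parameter relations\<close>

lemma A'_param_4:
  assumes "n > 0"
  shows "A'_param 4 n = A_param 4 n + sqrt 2"
proof -
  define q where "q = nome 4 n"
  have q: "0 < q" "q < 1" using assms by (simp_all add: q_def nome_bounds)
  have "(4::real) powr (1/4) = sqrt 2"
    using powr_powr[of 2 2 "1/4"] by (simp add: powr_half_sqrt)
  moreover have "q powr 8 = q ^ 8" using q by simp
  ultimately have c: "A_denom 4 q = 2 * sqrt 2 * q * ramanujan_psi (q ^ 8)"
    using q by (simp add: A_denom_def)
  \<comment> \<open>The coefficient 4 of the theta identity is sqrt 2 times 2 sqrt 2, which leaves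
    the constant sqrt 2.\<close>
  have "ramanujan_phi q - ramanujan_phi (- q) = sqrt 2 * A_denom 4 q"
    using phi_diff_phi_minus[of q] q by (simp add: c)
  moreover have "A_denom 4 q \<noteq> 0" using A_denom_pos[of 4 q] q by simp
  ultimately show ?thesis
    by (simp add: A_param_eq A'_param_eq q_def[symmetric] field_simps)
qed

lemma A'_param_2:
  assumes "n > 0"
  shows "(A'_param 2 n)\<^sup>2 = (A_param 2 n)\<^sup>2 + sqrt 2"
proof -
  define q where "q = nome 2 n"
  have q: "0 < q" "q < 1" using assms by (simp_all add: q_def nome_bounds)
  have c: "(A_denom 2 q)\<^sup>2 = 4 * sqrt 2 * q * (ramanujan_psi (q ^ 4))\<^sup>2"
    using q powr_quarter_sq[of 2 1] powr_quarter_sq[of q 2]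
    by (simp add: A_denom_def power_mult_distrib powr_half_sqrt)
  have "(ramanujan_phi q)\<^sup>2 - (ramanujan_phi (- q))\<^sup>2 = sqrt 2 * (A_denom 2 q)\<^sup>2"
    using phi_sq_diff_phi_minus_sq[of q] q by (simp add: c)
  moreover have "A_denom 2 q \<noteq> 0" using A_denom_pos[of 2 q] q by simp
  ultimately show ?thesis
    by (simp add: A_param_eq A'_param_eq q_def[symmetric] field_simps)
qed

lemma A'_param_1:
  assumes "n > 0"
  shows "(A'_param 1 n) ^ 4 = (A_param 1 n) ^ 4 + 1"
proof -
  define q where "q = nome 1 n"
  have q: "0 < q" "q < 1" using assms by (simp_all add: q_def nome_bounds)
  have c: "(A_denom 1 q) ^ 4 = 16 * q * (ramanujan_psi (q\<^sup>2)) ^ 4"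
    using q powr_quarter_pow4[of q 1] by (simp add: A_denom_def power_mult_distrib)
  have "(ramanujan_phi q) ^ 4 - (ramanujan_phi (- q)) ^ 4 = (A_denom 1 q) ^ 4"
    using phi_pow4_diff_phi_minus_pow4[of q] q by (simp add: c)
  moreover have "A_denom 1 q \<noteq> 0" using A_denom_pos[of 1 q] q by simp
  ultimately show ?thesis
    by (simp add: A_param_eq A'_param_eq q_def[symmetric] field_simps)
qed

text \<open>For k = 1/2 the argument of psi is q itself, so the quartic identity, which involves
  psi(q^2), enters only through \<open>psi_sq\<close>. That brings in phi(q)^4, the source of the
  negative fourth power.\<close>

lemma A'_param_half:
  assumes "n > 0"
  shows "4 * (A'_param (1/2) n) ^ 4 - (A'_param (1/2) n) powi (-4) = 4 * (A_param (1/2) n) ^ 4"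
proof -
  define q where "q = nome (1/2) n"
  have q: "0 < q" "q < 1" using assms by (simp_all add: q_def nome_bounds)
  define P M c where "P = ramanujan_phi q" and "M = ramanujan_phi (- q)" and "c = A_denom (1/2) q"
  have c4: "c ^ 4 = 8 * sqrt q * (ramanujan_psi q) ^ 4"
    using q powr_quarter_pow4[of "1/2" 1] powr_quarter_pow4[of q "1/2"]
    by (simp add: c_def A_denom_def power_mult_distrib powr_half_sqrt)
  have "c ^ 8 = (c ^ 4)\<^sup>2" by (simp flip: power_mult)
  also have "\<dots> = 64 * q * ((ramanujan_psi q)\<^sup>2) ^ 4"
    unfolding c4 using q by (simp add: power_mult_distrib flip: power_mult)
  also have "\<dots> = 4 * (P ^ 4 - M ^ 4) * P ^ 4"
    using psi_sq[of q] phi_pow4_diff_phi_minus_pow4[of q] q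
    by (simp add: P_def M_def power_mult_distrib)
  finally have "c ^ 8 = 4 * (P ^ 4 - M ^ 4) * P ^ 4" .
  moreover have "c > 0" "P > 0" using A_denom_pos[of "1/2" q] phi_pos q by (auto simp: c_def P_def)
  \<comment> \<open>This is the preceding equation divided by c^4 P^4.\<close>
  ultimately have "4 * (P / c) ^ 4 - (P / c) powi (-4) = 4 * (M / c) ^ 4"
    by (simp add: power_int_minus power_divide divide_simps)
       (simp add: algebra_simps power_numeral_reduce)
  thus ?thesis
    by (simp add: A_param_eq A'_param_eq q_def P_def M_def c_def)
qed

theorem theorem4p1:
  fixes n :: real
  assumes "n > 0"
  shows "A'_param 4 n = A_param 4 n + sqrt 2 \<and>
    A'_param 2 n = sqrt ((A_param 2 n)\<^sup>2 + sqrt 2) \<and>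
    A'_param 1 n = root 4 ((A_param 1 n) ^ 4 + 1) \<and>
    4 * (A'_param (1/2) n) ^ 4 - (A'_param (1/2) n) powi (-4) = 4 * (A_param (1/2) n) ^ 4"
proof (intro conjI)
  \<comment> \<open>Here and for k = 1, positivity of \<open>A'_param\<close> selects the positive
    root.\<close>
  show "A'_param 2 n = sqrt ((A_param 2 n)\<^sup>2 + sqrt 2)"
    using A'_param_pos[of 2 n] assms by (simp flip: A'_param_2[OF assms])
  show "A'_param 1 n = root 4 ((A_param 1 n) ^ 4 + 1)"
    using A'_param_pos[of 1 n] assms by (simp add: real_root_power_cancel flip: A'_param_1[OF assms])
qed (use assms A'_param_4 A'_param_half in auto)

end
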